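(* Let $K$ be a field of characteristic different from $2$, let $\mathcal C$ be the conic section and $\ell$ the linear rational map with coefficients $A,B,C,D,E,F\in K$ and $a,b,c,d,e,f\in K$ described in the context, with associated $\mathrm{Disc}(t)$ and $x_1(t),x_2(t),x_0(t)$. Assume that there exists $t_0\in K$ such that $\sqrt{\mathrm{Disc}(t_0)}\in K$, and define the quantity $$k=\frac{\mathrm{Disc}'(t_0)^2-2\,\mathrm{Disc}(t_0)\,\mathrm{Disc}''(t_0)}{\mathrm{Disc}'(t_0)^2}\in K$$ (so $\mathrm{Disc}'(t_0)\neq0$). (1) For every $n\ge 2$ there exist nontrivial (that is, non-constant) sequences $\{t_1,t_2,\dots,t_n\}\subseteq K$ such that each $\sqrt{\mathrm{Disc}(t_i)}\in K$. In particular, each $K$-rational point $P_i=\bigl(x_1(t_i):x_2(t_i):x_0(t_i)\bigr)$ is in $\mathcal C(K)$, and $\ell(P_{i+1})-\ell(P_i)=t_{i+1}-t_i$. (2) There exists an arithmetic progression $\{P_1,P_2,P_3\}\subseteq\mathbb P^2(K)$ on $\mathcal C$ with respect to $\ell$. Moreover, the points of such a progression (with $\ell(P_2)=t_0$) must necessarily be of the form $P_i=\bigl(x_1(t_i):x_2(t_i):x_0(t_i)\bigr)$ in terms of $$t_1=t_0-\delta,\qquad t_2=t_0,\qquad t_3=t_0+\delta,$$ where $$\delta=-\frac{\mathrm{Disc}(t_0)}{\mathrm{Disc}'(t_0)}\cdot\frac{4XY}{Y^2+2XY+kX^2}$$ for some $K$-rational point $(X:Y:1)$ on the cubic curve $$\mathcal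 E_k:\quad Y^2+4XY+4kY=X^3+kX^2 .$$
   Context: The conic section is $$\mathcal C=\{(x_1:x_2:x_0)\in\mathbb P^2 : A x_1^2+2B x_1x_2+C x_2^2+2D x_1x_0+2E x_2x_0+F x_0^2=0\},$$ and the linear rational map $\ell:\mathcal C(K)\to\mathbb P^1(K)$ is $$\ell(x_1:x_2:x_0)=\frac{a x_1+b x_2+c x_0}{d x_1+e x_2+f x_0}.$$ A set $\{P_1,\dots,P_n\}\subseteq\mathbb P^2(K)$ is an arithmetic progression on $\mathcal C$ with respect to $\ell$ if each $P_i\in\mathcal C(K)$ and there is a common difference $\delta=\ell(P_{i+1})-\ell(P_i)$ (the same for all $i$). The discriminant is the polynomial in $t$ (of degree at most 2) $$\mathrm{Disc}(t)=\begin{bmatrix}a-dt\\ b-et\\ c-ft\end{bmatrix}^T\begin{bmatrix}E^2-CF & BF-DE & CD-BE\\ BF-DE & D^2-AF & AE-BD\\ CD-BE & AE-BD & B^2-AC\end{bmatrix}\begin{bmatrix}a-dt\\ b-et\\ c-ft\end{bmatrix},$$ with $\mathrm{Disc}'$, $\mathrm{Disc}''$ its first and second derivatives in $t$. The condition $\sqrt{\mathrm{Disc}(t)}\in K$ means that $\mathrm{Disc}(t)$ is a square in $K$. The coordinates are $$x_1(t)=B(b-et)(c-ft)-C(a-dt)(c-ft)-D(b-et)^2+E(a-dt)(b-et)\pm(b-et)\sqrt{\mathrm{Disc}(t)},$$ $$x_2(t)=-A(b-et)(c-ft)+B(a-dt)(c-ft)+D(a-dt)(b-et)-E(a-dt)^2\mp(a-dt)\sqrt{\mathrm{Disc}(t)},$$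 $$x_0(t)=A(b-et)^2-2B(a-dt)(b-et)+C(a-dt)^2,$$ where the upper signs are taken together or the lower signs are taken together.
   Formalization: (1) omits triples (0,0,0) and P_i where ℓ is undefined. (2): the form of P_i is claimed only if x_0(t_i)≠0; the δ-formula is not claimed if Disc(t_0)=0≠δ, or if k=0 and δ=0 or Disc(t_0±δ)=0 for a sign. Progressions may be constant. *)

theory Defs
  imports "HOL-Analysis.Analysis" "HOL-Computational_Algebra.Computational_Algebra"
begin

text \<open>Homogeneous coordinates are listed in the order \<open>(x1, x2, x0)\<close>.\<close>

definition proj_rel :: "'a::field \<times> 'a \<times> 'a \<Rightarrow> 'a \<times> 'a \<times> 'a \<Rightarrow> bool" where
  "proj_rel v w \<longleftrightarrow> v \<noteq> (0, 0, 0) \<and> w \<noteq> (0, 0, 0) \<and>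
     (\<exists>u. u \<noteq> 0 \<and> w = (case v of (x1, x2, x0) \<Rightarrow> (u * x1, u * x2, u * x0)))"

lemma part_equivp_proj_rel: "part_equivp proj_rel"
proof (rule part_equivpI)
  show "\<exists>v::'a \<times> 'a \<times> 'a. proj_rel v v"
    by (rule exI[of _ "(1, 0, 0)"]) (auto simp: proj_rel_def intro!: exI[of _ 1])
  show "symp (proj_rel :: 'a \<times> 'a \<times> 'a \<Rightarrow> _)"
  proof (rule sympI)
    fix v w :: "'a \<times> 'a \<times> 'a"
    assume *: "proj_rel v w"
    then obtain u x1 x2 x0 where u: "u \<noteq> 0" "v = (x1, x2, x0)" "w = (u * x1, u * x2, u * x0)"
      unfolding proj_rel_def by (cases v) auto
    then show "proj_rel w v"
      using * by (auto simp: proj_rel_def intro!: exI[of _ "inverse u"])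
  qed
  show "transp (proj_rel :: 'a \<times> 'a \<times> 'a \<Rightarrow> _)"
  proof (rule transpI)
    fix v w z :: "'a \<times> 'a \<times> 'a"
    assume *: "proj_rel v w" "proj_rel w z"
    obtain u x1 x2 x0 where u: "u \<noteq> 0" "v = (x1, x2, x0)" "w = (u * x1, u * x2, u * x0)"
      using *(1) unfolding proj_rel_def by (cases v) auto
    obtain u' where u': "u' \<noteq> 0" "z = (u' * (u * x1), u' * (u * x2), u' * (u * x0))"
      using *(2) u unfolding proj_rel_def by auto
    have "v \<noteq> (0, 0, 0)" "z \<noteq> (0, 0, 0)"
      using * unfolding proj_rel_def by blast+
    then show "proj_rel v z"
      using u u' by (auto simp: proj_rel_def mult.assoc intro!: exI[of _ "u' * u"])
  qed
qed

quotient_type (overloaded) 'a proj_plane = "'a::field \<times> 'a \<times> 'a" / partial: proj_rel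
  by (rule part_equivp_proj_rel)

text \<open>
  \<open>has_coords P (x1, x2, x0)\<close> says \<open>P = (x1 : x2 : x0)\<close>; in particular the triple is then
  nonzero, so that it is a legitimate triple of homogeneous coordinates.
\<close>

lift_definition has_coords :: "'a::field proj_plane \<Rightarrow> 'a \<times> 'a \<times> 'a \<Rightarrow> bool" is proj_rel
proof -
  fix v w :: "'a \<times> 'a \<times> 'a"
  assume "proj_rel v w"
  then show "proj_rel v = proj_rel w"
    using part_equivp_proj_rel unfolding part_equivp_def by blast
qed

text \<open>The tuples are \<open>(A, B, C, D, E, F)\<close> and \<open>(a, b, c, d, e, f)\<close>; \<open>B\<close>, \<open>D\<close>, \<open>E\<close> are half the
  mixed coefficients of the form.\<close>

type_synonym 'a conic = "'a \<times> 'a \<times> 'a \<times> 'a \<times> 'a \<times> 'a"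
type_synonym 'a linmap = "'a \<times> 'a \<times> 'a \<times> 'a \<times> 'a \<times> 'a"

fun conic_form :: "'a::field conic \<Rightarrow> 'a \<times> 'a \<times> 'a \<Rightarrow> 'a" where
  "conic_form (A, B, C, D, E, F) (x1, x2, x0) =
     A * x1^2 + 2 * B * x1 * x2 + C * x2^2 + 2 * D * x1 * x0 + 2 * E * x2 * x0 + F * x0^2"

fun ell_num :: "'a::field linmap \<Rightarrow> 'a \<times> 'a \<times> 'a \<Rightarrow> 'a" where
  "ell_num (a, b, c, d, e, f) (x1, x2, x0) = a * x1 + b * x2 + c * x0"

fun ell_den :: "'a::field linmap \<Rightarrow> 'a \<times> 'a \<times> 'a \<Rightarrow> 'a" where
  "ell_den (a, b, c, d, e, f) (x1, x2, x0) = d * x1 + e * x2 + f * x0"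

lemma conic_form_scale:
  "conic_form Q (u * x1, u * x2, u * x0) = u^2 * conic_form Q (x1, x2, x0)"
  by (cases Q) (simp add: algebra_simps power2_eq_square)

lemma ell_num_scale: "ell_num L (u * x1, u * x2, u * x0) = u * ell_num L (x1, x2, x0)"
  by (cases L) (simp add: algebra_simps)

lemma ell_den_scale: "ell_den L (u * x1, u * x2, u * x0) = u * ell_den L (x1, x2, x0)"
  by (cases L) (simp add: algebra_simps)

lift_definition on_conic :: "'a::field conic \<Rightarrow> 'a proj_plane \<Rightarrow> bool"
  is "\<lambda>Q v. conic_form Q v = 0"
  by (auto simp: proj_rel_def conic_form_scale)

text \<open>
  As a map to the projective line, \<open>\<ell>\<close> takes the value \<open>ell_num : ell_den\<close>. It is undefined at
  its base points, finite where the denominator is nonzero, and \<open>\<infinity>\<close> at all other points. The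
  number \<open>ell L P\<close> is meaningful only where \<open>\<ell>\<close> is finite.
\<close>

lift_definition base_point :: "'a::field linmap \<Rightarrow> 'a proj_plane \<Rightarrow> bool"
  is "\<lambda>L v. ell_num L v = 0 \<and> ell_den L v = 0"
  by (auto simp: proj_rel_def ell_num_scale ell_den_scale)

lift_definition ell_finite :: "'a::field linmap \<Rightarrow> 'a proj_plane \<Rightarrow> bool"
  is "\<lambda>L v. ell_den L v \<noteq> 0"
  by (auto simp: proj_rel_def ell_den_scale)

lift_definition ell :: "'a::field linmap \<Rightarrow> 'a proj_plane \<Rightarrow> 'a"
  is "\<lambda>L v. ell_num L v / ell_den L v"
  by (auto simp: proj_rel_def ell_num_scale ell_den_scale)

text \<open>The progression \<open>P 1, \<dots>, P n\<close>; the common difference is allowed to be zero.\<close>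

definition arith_prog :: "'a::field conic \<Rightarrow> 'a linmap \<Rightarrow> nat \<Rightarrow> (nat \<Rightarrow> 'a proj_plane) \<Rightarrow> bool" where
  "arith_prog Q L n P \<longleftrightarrow>
     (\<forall>i\<in>{1..n}. on_conic Q (P i) \<and> ell_finite L (P i)) \<and>
     (\<exists>\<delta>. \<forall>i\<in>{1..<n}. ell L (P (Suc i)) - ell L (P i) = \<delta>)"

fun disc_matrix :: "'a::field conic \<Rightarrow> 'a^3^3" where
  "disc_matrix (A, B, C, D, E, F) = vector
     [vector [E^2 - C * F, B * F - D * E, C * D - B * E],
      vector [B * F - D * E, D^2 - A * F, A * E - B * D],
      vector [C * D - B * E, A * E - B * D, B^2 - A * C]]"

fun disc_vector :: "'a::field linmap \<Rightarrow> 'a poly^3" where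
  "disc_vector (a, b, c, d, e, f) = vector [[:a, - d:], [:b, - e:], [:c, - f:]]"

definition Disc :: "'a::field conic \<Rightarrow> 'a linmap \<Rightarrow> 'a poly" where
  "Disc Q L = (\<Sum>i\<in>UNIV. \<Sum>j\<in>UNIV. disc_vector L $ i * [:disc_matrix Q $ i $ j:] * disc_vector L $ j)"

fun coord0 :: "'a::field conic \<Rightarrow> 'a linmap \<Rightarrow> 'a \<Rightarrow> 'a" where
  "coord0 (A, B, C, D, E, F) (a, b, c, d, e, f) t =
     A * (b - e * t)^2 - 2 * B * (a - d * t) * (b - e * t) + C * (a - d * t)^2"

text \<open>
  The triple \<open>(x1(t), x2(t), x0(t))\<close>, where \<open>s\<close> is a square root of \<open>Disc(t)\<close>. The root \<open>s\<close> gives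
  the upper signs and the root \<open>- s\<close> the lower signs.
\<close>

fun coords :: "'a::field conic \<Rightarrow> 'a linmap \<Rightarrow> 'a \<Rightarrow> 'a \<Rightarrow> 'a \<times> 'a \<times> 'a" where
  "coords (A, B, C, D, E, F) (a, b, c, d, e, f) t s =
    (B * (b - e * t) * (c - f * t) - C * (a - d * t) * (c - f * t) - D * (b - e * t)^2
       + E * (a - d * t) * (b - e * t) + (b - e * t) * s,
     - A * (b - e * t) * (c - f * t) + B * (a - d * t) * (c - f * t)
       + D * (a - d * t) * (b - e * t) - E * (a - d * t)^2 - (a - d * t) * s,
     coord0 (A, B, C, D, E, F) (a, b, c, d, e, f) t)"

text \<open>Numerator and denominator of \<open>\<ell>\<close> are linearly independent, i.e. \<open>\<ell>\<close> is a nonconstant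
  rational map on the plane.\<close>

definition nonconstant_map :: "'a::field linmap \<Rightarrow> bool" where
  "nonconstant_map L \<longleftrightarrow>
     (\<forall>u v. (\<forall>x. u * ell_num L x + v * ell_den L x = 0) \<longrightarrow> u = 0 \<and> v = 0)"

text \<open>The affine part of the cubic: \<open>on_cubic k X Y\<close> says that \<open>(X : Y : 1)\<close> lies on it.\<close>

definition on_cubic :: "'a::field \<Rightarrow> 'a \<Rightarrow> 'a \<Rightarrow> bool" where
  "on_cubic k X Y \<longleftrightarrow> Y^2 + 4 * X * Y + 4 * k * Y = X^3 + k * X^2"

end

theory Submission
  imports Defs
begin

text \<open>
  The points of the conic where \<open>\<ell> = t\<close> lie on the line with coefficient vector
  \<open>n = num - t den\<close>, and \<open>Disc(t)\<close> is minus the adjugate form at \<open>n\<close>. By the Lagrange-type identity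
  for \<open>n = x \<times> y\<close> it equals \<open>polar(x, y)^2 - Q(x) Q(y)\<close>, a square as soon as the line contains a
  point \<open>x\<close> of the conic. Conversely, if \<open>Disc(t)\<close> is a square the line meets the conic in a
  rational point; since \<open>Disc'(t)\<close> does not vanish, one can avoid the base point of \<open>\<ell>\<close>.
  Sequences of squares come from parametrising the conic \<open>s^2 = Disc(t)\<close> by lines through
  \<open>(t0, s0)\<close>. Finally, with \<open>g = Disc'(t0) \<delta> / (2 Disc(t0))\<close>, three terms require
  \<open>(1 + g)^2 - k g^2\<close> and \<open>(1 - g)^2 - k g^2\<close> to be squares, and the solutions of this pair
  of conditions are parametrised by the cubic.
\<close>

section \<open>Cross products, and the polar and dual forms of a conic\<close>

fun num_coeffs :: "'a linmap \<Rightarrow> 'a \<times> 'a \<times> 'a" where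
  "num_coeffs (a, b, c, d, e, f) = (a, b, c)"

fun den_coeffs :: "'a linmap \<Rightarrow> 'a \<times> 'a \<times> 'a" where
  "den_coeffs (a, b, c, d, e, f) = (d, e, f)"

fun scale :: "'a::field \<Rightarrow> 'a \<times> 'a \<times> 'a \<Rightarrow> 'a \<times> 'a \<times> 'a" where
  "scale u (x1, x2, x0) = (u * x1, u * x2, u * x0)"

fun dot :: "'a::field \<times> 'a \<times> 'a \<Rightarrow> 'a \<times> 'a \<times> 'a \<Rightarrow> 'a" where
  "dot (x1, x2, x0) (y1, y2, y0) = x1 * y1 + x2 * y2 + x0 * y0"

fun cross :: "'a::field \<times> 'a \<times> 'a \<Rightarrow> 'a \<times> 'a \<times> 'a \<Rightarrow> 'a \<times> 'a \<times> 'a" where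
  "cross (x1, x2, x0) (y1, y2, y0) = (x2 * y0 - x0 * y2, x0 * y1 - x1 * y0, x1 * y2 - x2 * y1)"

fun polar :: "'a::field conic \<Rightarrow> 'a \<times> 'a \<times> 'a \<Rightarrow> 'a \<times> 'a \<times> 'a \<Rightarrow> 'a" where
  "polar (A, B, C, D, E, F) (x1, x2, x0) (y1, y2, y0) =
     A * x1 * y1 + B * (x1 * y2 + x2 * y1) + C * x2 * y2
       + D * (x1 * y0 + x0 * y1) + E * (x2 * y0 + x0 * y2) + F * x0 * y0"

text \<open>The symmetric bilinear form of \<open>disc_matrix\<close>, that is, of minus the
  adjugate of the Gram matrix of \<open>conic_form\<close>. Two arguments are kept because the
  derivative of Disc is a mixed value.\<close>

fun dual :: "'a::field conic \<Rightarrow> 'a \<times> 'a \<times> 'a \<Rightarrow> 'a \<times> 'a \<times> 'a \<Rightarrow> 'a" where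
  "dual (A, B, C, D, E, F) (u1, u2, u0) (v1, v2, v0) =
     (E^2 - C * F) * u1 * v1 + (B * F - D * E) * (u1 * v2 + u2 * v1) + (D^2 - A * F) * u2 * v2
       + (C * D - B * E) * (u1 * v0 + u0 * v1) + (A * E - B * D) * (u2 * v0 + u0 * v2)
       + (B^2 - A * C) * u0 * v0"

definition line :: "'a::field linmap \<Rightarrow> 'a \<Rightarrow> 'a \<times> 'a \<times> 'a" where
  "line L t = num_coeffs L - scale t (den_coeffs L)"

lemma dot_cross_left: "dot x (cross x y) = 0" "dot y (cross x y) = 0"
  by (cases x; cases y; simp add: algebra_simps)+

lemma dot_commute: "dot x y = dot y x"
  by (cases x; cases y; simp add: algebra_simps)

lemma dot_cross_rotate: "dot x (cross y z) = dot z (cross x y)"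
  by (cases x; cases y; cases z; simp add: algebra_simps)

lemma dot_add: "dot x (y + z) = dot x y + dot x z"
  by (cases x; cases y; cases z; simp add: algebra_simps)

lemma dot_diff: "dot (x - y) z = dot x z - dot y z"
  by (cases x; cases y; cases z; simp add: algebra_simps)

lemma dot_scale: "dot x (scale u y) = u * dot x y"  "dot (scale u x) y = u * dot x y"
  by (cases x; cases y; simp add: algebra_simps)+

lemma dot_eq_1_exists:
  fixes x :: "'a::field \<times> 'a \<times> 'a"
  assumes "x \<noteq> (0, 0, 0)"
  shows "\<exists>r. dot x r = 1"
proof -
  obtain x1 x2 x0 where x: "x = (x1, x2, x0)" by (cases x)
  have "x1 \<noteq> 0 \<or> x2 \<noteq> 0 \<or> x0 \<noteq> 0" using assms x by auto
  then have "dot x (1 / x1, 0, 0) = 1 \<or> dot x (0, 1 / x2, 0) = 1 \<or> dot x (0, 0, 1 / x0) = 1"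
    using x by auto
  then show ?thesis by blast
qed

lemma cross_cross: "cross x (cross y z) = scale (dot x z) y - scale (dot x y) z"
  by (cases x; cases y; cases z; simp add: algebra_simps)

lemma cross_cross_left: "cross (cross x y) z = scale (dot x z) y - scale (dot y z) x"
  by (cases x; cases y; cases z; simp add: algebra_simps)

lemma cross_exists:
  fixes m :: "'a::field \<times> 'a \<times> 'a"
  assumes "m \<noteq> (0, 0, 0)"
  shows "\<exists>p q. cross p q = m"
proof -
  obtain m1 m2 m0 where m: "m = (m1, m2, m0)" by (cases m)
  consider "m1 \<noteq> 0" | "m2 \<noteq> 0" | "m0 \<noteq> 0" using assms m by auto
  then show ?thesis
  proof cases
    case 1
    then have "cross (- m2, m1, 0) (- m0 / m1, 0, 1) = m" using m by (simp add: field_simps)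
    then show ?thesis by blast
  next
    case 2
    then have "cross (0, - m0, m2) (1, - m1 / m2, 0) = m" using m by (simp add: field_simps)
    then show ?thesis by blast
  next
    case 3
    then have "cross (m0, 0, - m1) (0, 1, - m2 / m0) = m" using m by (simp add: field_simps)
    then show ?thesis by blast
  qed
qed

lemma conic_form_scale': "conic_form Q (scale u x) = u^2 * conic_form Q x"
  by (cases x) (simp add: conic_form_scale)

lemma conic_form_add: "conic_form Q (x + y) = conic_form Q x + 2 * polar Q x y + conic_form Q y"
  by (cases Q; cases x; cases y; simp add: algebra_simps power2_eq_square)

lemma polar_scale: "polar Q x (scale u y) = u * polar Q x y"
  by (cases Q; cases x; cases y; simp add: algebra_simps)

lemma polar_add: "polar Q x (y + z) = polar Q x y + polar Q x z"
  by (cases Q; cases x; cases y; cases z; simp add: algebra_simps)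

lemma polar_commute: "polar Q x y = polar Q y x"
  by (cases Q; cases x; cases y; simp add: algebra_simps)

lemma polar_self: "polar Q x x = conic_form Q x"
  by (cases Q; cases x; simp add: algebra_simps power2_eq_square)

lemma dual_scale: "dual Q (scale u m) n = u * dual Q m n" "dual Q m (scale u n) = u * dual Q m n"
  by (cases Q; cases m; cases n; simp add: algebra_simps)+

lemma dual_diff_left: "dual Q (m - m') n = dual Q m n - dual Q m' n"
  by (cases Q; cases m; cases m'; cases n; simp add: algebra_simps)

lemma dual_commute: "dual Q m n = dual Q n m"
  by (cases Q; cases m; cases n; simp add: algebra_simps)

text \<open>If M is the Gram matrix of \<open>Q\<close>, its adjugate sends \<open>cross x y\<close>
  to the cross product of M x and M y, so this is the Binet-Cauchy identity.\<close>

lemma dual_cross: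
  "dual Q (cross x y) (cross x z) = polar Q x y * polar Q x z - conic_form Q x * polar Q y z"
  by (cases Q; cases x; cases y; cases z; simp add: algebra_simps power2_eq_square)

lemma dual_cross_self:
  "dual Q (cross x y) (cross x y) = (polar Q x y)^2 - conic_form Q x * conic_form Q y"
  by (simp add: dual_cross polar_self power2_eq_square)

lemma ell_num_eq_dot: "ell_num L x = dot (num_coeffs L) x"
  by (cases L; cases x; simp)

lemma ell_den_eq_dot: "ell_den L x = dot (den_coeffs L) x"
  by (cases L; cases x; simp)

lemma dot_line: "dot (line L t) x = ell_num L x - t * ell_den L x"
  by (simp add: line_def dot_diff dot_scale ell_num_eq_dot ell_den_eq_dot)

section \<open>The discriminant and its derivatives in terms of the dual form\<close>

lemma Disc_eq:
  "Disc Q L = [:dual Q (num_coeffs L) (num_coeffs L),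
                - 2 * dual Q (num_coeffs L) (den_coeffs L),
                dual Q (den_coeffs L) (den_coeffs L):]"
  by (cases Q; cases L) (simp add: Disc_def sum_3 algebra_simps power2_eq_square)

lemma poly_Disc: "poly (Disc Q L) t = dual Q (line L t) (line L t)"
  unfolding Disc_eq
  by (simp add: line_def dual_diff_left dual_scale dual_commute[of Q _ "_ - _"]
      dual_commute[of Q "den_coeffs L" "num_coeffs L"] algebra_simps power2_eq_square)

text \<open>This turns the nonvanishing of Disc' into that of \<open>dual\<close> at the denominator
  and the line, the form in which it is used to find points off the base point.\<close>

lemma poly_pderiv_Disc: "poly (pderiv (Disc Q L)) t = - 2 * dual Q (den_coeffs L) (line L t)"
  unfolding Disc_eq
  by (simp add: line_def dual_diff_left dual_scale dual_commute[of Q _ "_ - _"] pderiv_pCons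
      dual_commute[of Q "den_coeffs L" "num_coeffs L"] algebra_simps power2_eq_square)

lemma Disc_taylor:
  "poly (Disc Q L) (t + h) = poly (Disc Q L) t + poly (pderiv (Disc Q L)) t * h
     + dual Q (den_coeffs L) (den_coeffs L) * h^2"
  unfolding Disc_eq
  by (simp add: pderiv_pCons algebra_simps power2_eq_square)

lemma poly_pderiv_pderiv_Disc:
  "poly (pderiv (pderiv (Disc Q L))) t = 2 * dual Q (den_coeffs L) (den_coeffs L)"
  unfolding Disc_eq
  by (simp add: pderiv_pCons algebra_simps)

section \<open>The coordinate formulas for an arbitrary line\<close>

fun line_point :: "'a::field conic \<Rightarrow> 'a \<times> 'a \<times> 'a \<Rightarrow> 'a \<Rightarrow> 'a \<times> 'a \<times> 'a" where
  "line_point (A, B, C, D, E, F) (u, v, w) s =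
    (B * v * w - C * u * w - D * v^2 + E * u * v + v * s,
     - A * v * w + B * u * w + D * u * v - E * u^2 - u * s,
     A * v^2 - 2 * B * u * v + C * u^2)"

lemma coords_eq: "coords Q L t s = line_point Q (line L t) s"
  by (cases Q; cases L) (simp add: line_def mult.commute)

lemma coord0_eq: "coord0 Q L t = snd (snd (line_point Q (line L t) s))"
  by (cases Q; cases L) (simp add: line_def mult.commute)

text \<open>For n = (u, v, w), varying \<open>s\<close> adds multiples of (v, -u, 0), the point at
  infinity of the line. The third coordinate is the form at that point, hence the leading
  coefficient of this quadratic in \<open>s\<close>; the linear term vanishes.\<close>

lemma conic_form_line_point:
  "conic_form Q (line_point Q n s) = snd (snd (line_point Q n s)) * (s^2 - dual Q n n)"
  by (cases Q; cases n; simp add: algebra_simps power2_eq_square)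

lemma dot_line_point: "dot n (line_point Q n s) = 0"
  by (cases Q; cases n; simp add: algebra_simps power2_eq_square)

text \<open>When \<open>x\<close> lies on the conic, the coefficient of \<open>y\<close> is zero, so
  the formula returns a multiple of \<open>x\<close>: this recovers a given conic point from the
  formula.\<close>

lemma line_point_cross:
  "line_point Q (cross x y) (polar Q x y) =
     scale (snd (snd x) * conic_form Q y - 2 * snd (snd y) * polar Q x y) x
     + scale (snd (snd y) * conic_form Q x) y"
  by (cases Q; cases x; cases y; simp add: algebra_simps power2_eq_square)

section \<open>Passing from projective points to representatives\<close>

lemma has_coords_exists:
  fixes x :: "'a::field \<times> 'a \<times> 'a"
  assumes "x \<noteq> (0, 0, 0)"
  shows "\<exists>P. has_coords P x"
proof -
  have "proj_rel x x"
    unfolding proj_rel_def using assms by (cases x) (intro conjI exI[of _ 1]; simp)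
  then show ?thesis by transfer blast
qed

lemma obtain_coords:
  obtains x where "has_coords P x" "x \<noteq> (0, 0, 0)"
proof -
  have "\<exists>x. has_coords P x \<and> x \<noteq> (0, 0, 0)"
    by transfer (auto simp: proj_rel_def)
  then show thesis using that by blast
qed

lemma has_coords_scale: "has_coords P x \<Longrightarrow> u \<noteq> 0 \<Longrightarrow> has_coords P (scale u x)"
proof transfer
  fix v x :: "'a \<times> 'a \<times> 'a" and u :: 'a
  assume "proj_rel v x" "u \<noteq> 0"
  moreover have "proj_rel x (scale u x)"
    using calculation by (cases x) (auto simp: proj_rel_def)
  ultimately show "proj_rel v (scale u x)"
    using part_equivp_transp[OF part_equivp_proj_rel] by blast
qed

lemma on_conic_iff: "has_coords P x \<Longrightarrow> on_conic Q P \<longleftrightarrow> conic_form Q x = 0"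
  by transfer (auto simp: proj_rel_def conic_form_scale)

lemma base_point_iff:
  "has_coords P x \<Longrightarrow> base_point L P \<longleftrightarrow> ell_num L x = 0 \<and> ell_den L x = 0"
  by transfer (auto simp: proj_rel_def ell_num_scale ell_den_scale)

lemma ell_finite_iff: "has_coords P x \<Longrightarrow> ell_finite L P \<longleftrightarrow> ell_den L x \<noteq> 0"
  by transfer (auto simp: proj_rel_def ell_den_scale)

lemma ell_eq: "has_coords P x \<Longrightarrow> ell L P = ell_num L x / ell_den L x"
  by transfer (auto simp: proj_rel_def ell_num_scale ell_den_scale)

section \<open>Points given by the formulas, and the converse\<close>

lemma ell_coords:
  assumes "has_coords P (coords Q L t s)" "\<not> base_point L P"
  shows "ell_finite L P" "ell L P = t"
proof -
  let ?x = "coords Q L t s"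
  have "ell_num L ?x = t * ell_den L ?x"
    using dot_line_point[of "line L t" Q s] by (simp add: coords_eq dot_line)
  moreover from this have "ell_den L ?x \<noteq> 0"
    using assms base_point_iff[OF assms(1), of L] by auto
  ultimately show "ell_finite L P" "ell L P = t"
    using ell_finite_iff[OF assms(1), of L] ell_eq[OF assms(1), of L] by auto
qed

lemma on_conic_coords:
  assumes "has_coords P (coords Q L t s)" "s^2 = poly (Disc Q L) t"
  shows "on_conic Q P"
  using assms(2) by (simp add: on_conic_iff[OF assms(1)] coords_eq conic_form_line_point poly_Disc)

text \<open>The root is \<open>polar Q x y\<close> for any \<open>y\<close> with
  \<open>cross x y = n\<close>. The third coordinate must be nonzero because the multiple of
  \<open>x\<close> produced by the formula can be zero otherwise.\<close>

lemma conic_point_on_line: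
  assumes "conic_form Q x = 0" "x \<noteq> (0, 0, 0)" "dot n x = 0"
  shows "\<exists>s. s^2 = dual Q n n \<and>
           (snd (snd (line_point Q n s)) \<noteq> 0 \<longrightarrow> (\<exists>u. u \<noteq> 0 \<and> line_point Q n s = scale u x))"
proof -
  obtain r where r: "dot x r = 1" using dot_eq_1_exists[OF assms(2)] by blast
  \<comment> \<open>By the triple product expansion \<open>cross x y\<close> is (x.r) n - (x.n) r,
    which is \<open>n\<close>.\<close>
  define y where "y = cross n r"
  define s where "s = polar Q x y"
  define u where "u = snd (snd x) * conic_form Q y - 2 * snd (snd y) * polar Q x y"
  have n: "cross x y = n"
    unfolding y_def cross_cross r using assms(3)
    by (cases n; cases r) (simp add: dot_commute[of x])
  have "s^2 = dual Q n n"
    using dual_cross_self[of Q x y] n assms(1) by (simp add: s_def)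
  moreover have "line_point Q n s = scale u x"
  proof -
    have "line_point Q n s = scale u x + scale (snd (snd y) * 0) y"
      using line_point_cross[of Q x y] by (simp only: s_def u_def n assms(1))
    also have "\<dots> = scale u x" by (cases x; cases y) simp
    finally show ?thesis .
  qed
  moreover from this have "u \<noteq> 0" if "snd (snd (line_point Q n s)) \<noteq> 0"
    using that by (cases x) auto
  ultimately show ?thesis by blast
qed

section \<open>Rational points of the conic where the map is finite\<close>

lemma cross_eq_0_imp_scale:
  assumes "cross n m = (0, 0, 0)" "dot m r = 1"
  shows "n = scale (dot r n) m"
  using cross_cross[of r n m] assms
  by (cases n; cases m; cases r) (simp add: algebra_simps)

text \<open>The line \<open>n\<close> without its intersection \<open>b\<close> with
  \<open>m\<close> is c + z b. On it the form is a quadratic in z with leading coefficient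
  \<open>conic_form Q b\<close> and quarter discriminant s^2. If the leading coefficient vanishes,
  \<open>nz\<close> keeps the linear one nonzero.\<close>

lemma conic_point_on_given_line:
  assumes two: "(2::'a::field) \<noteq> 0"
    and ind: "cross n m \<noteq> (0, 0, 0)"
    and sq: "s^2 = dual Q n n"
    and nz: "dual Q m n \<noteq> 0"
  shows "\<exists>x. conic_form Q x = 0 \<and> dot m x = (1::'a) \<and> dot n x = 0"
proof -
  define b where "b = cross n m"
  obtain r where r: "dot b r = 1" using dot_eq_1_exists[OF ind] b_def by auto
  \<comment> \<open>\<open>c\<close> lies on \<open>n\<close> and \<open>c'\<close> on
    \<open>m\<close>; with \<open>b\<close> they span these lines, so that \<open>dual_cross\<close>
    applies to both.\<close>
  define c where "c = cross r n"
  define c' where "c' = cross m r"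
  have rb: "dot r (cross n m) = 1" using r by (simp add: b_def dot_commute)
  have nb: "dot n b = 0" "dot m b = 0" by (simp_all add: b_def dot_cross_left)
  have nc: "dot n c = 0" "dot m c = 1" "dot n c' = 1" "dot m c' = 0"
    using rb dot_cross_rotate[of m r n] dot_cross_rotate[of n m r]
    by (simp_all add: c_def c'_def dot_cross_left)
  have n: "n = scale (- 1) (cross b c)"
    unfolding b_def cross_cross_left by (simp add: nc) (cases n; cases m; simp)
  have m: "m = cross b c'"
    unfolding b_def cross_cross_left by (simp add: nc) (cases n; cases m; simp)
  have disc: "s^2 = (polar Q b c)^2 - conic_form Q b * conic_form Q c"
    unfolding sq by (subst (1 2) n) (simp add: dual_scale dual_cross_self)
  have nz': "polar Q b c \<noteq> 0 \<or> conic_form Q b \<noteq> 0"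
    using nz by (subst (asm) n, subst (asm) m) (auto simp: dual_scale dual_cross)
  have Q: "conic_form Q (c + scale z b) = conic_form Q c + 2 * z * polar Q b c + z^2 * conic_form Q b"
    for z by (simp add: conic_form_add conic_form_scale' polar_scale polar_commute[of Q c])
  have "\<exists>z. conic_form Q (c + scale z b) = 0"
  proof (cases "conic_form Q b = 0")
    case True
    then show ?thesis
      using nz' two by (intro exI[of _ "- conic_form Q c / (2 * polar Q b c)"]) (simp add: Q)
  next
    case False
    let ?z = "(s - polar Q b c) / conic_form Q b"
    have "conic_form Q b * conic_form Q (c + scale ?z b) =
        conic_form Q b * conic_form Q c + 2 * (s - polar Q b c) * polar Q b c + (s - polar Q b c)^2"
      using False by (simp add: Q field_simps power2_eq_square)
    also have "\<dots> = 0"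
      using disc by (simp add: algebra_simps power2_eq_square)
    finally show ?thesis using False by auto
  qed
  then obtain z where "conic_form Q (c + scale z b) = 0" by blast
  then show ?thesis
    using nb nc by (intro exI[of _ "c + scale z b"]) (simp add: dot_add dot_scale)
qed

text \<open>The discriminant being a nonzero square, the line \<open>m\<close> is a secant: it meets the conic in a
  rational point \<open>p\<close> at which it is not tangent, and a secant through \<open>p\<close> ends outside of it.\<close>

lemma conic_point_off_secant:
  assumes two: "(2::'a::field) \<noteq> 0"
    and sq: "s^2 = dual Q m m" and nz: "s \<noteq> 0"
  shows "\<exists>x. conic_form Q x = 0 \<and> dot m x = (1::'a)"
proof -
  have m0: "m \<noteq> (0, 0, 0)"
    using sq nz by (cases Q) auto
  obtain r where r: "dot m r = 1" using dot_eq_1_exists[OF m0] by blast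
  obtain p q where pq: "cross p q = m" using cross_exists[OF m0] by blast
  have mpq: "dot m p = 0" "dot m q = 0"
    unfolding pq[symmetric] by (simp_all add: dot_cross_left dot_commute[of "cross p q"])
  have disc: "s^2 = (polar Q p q)^2 - conic_form Q p * conic_form Q q"
    using sq pq dual_cross_self[of Q p q] by simp
  have "\<exists>p q. dot m p = 0 \<and> dot m q = 0 \<and> conic_form Q p = 0 \<and> polar Q p q \<noteq> 0"
  proof (cases "conic_form Q p = 0")
    case True
    then have "polar Q p q \<noteq> 0" using disc nz by auto
    then show ?thesis using True mpq by blast
  next
    case False
    \<comment> \<open>A root z of the form at q + z p, whose quarter discriminant is s^2. The polar
      of the new point with \<open>p\<close> is \<open>s\<close>, hence nonzero.\<close>
    let ?z = "(s - polar Q p q) / conic_form Q p"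
    let ?p = "q + scale ?z p"
    have "conic_form Q p * conic_form Q ?p =
        conic_form Q p * conic_form Q q + 2 * (s - polar Q p q) * polar Q p q + (s - polar Q p q)^2"
      using False by (simp add: conic_form_add conic_form_scale' polar_scale polar_commute[of Q q]
          field_simps power2_eq_square)
    also have "\<dots> = 0"
      using disc by (simp add: algebra_simps power2_eq_square)
    finally have "conic_form Q ?p = 0" using False by simp
    moreover have "polar Q ?p p = s"
      using False by (simp add: polar_commute[of Q _ p] polar_add polar_scale polar_self)
    ultimately show ?thesis using mpq nz
      by (intro exI[of _ ?p] exI[of _ p]) (simp add: dot_add dot_scale)
  qed
  then obtain p q where pq: "dot m p = 0" "dot m q = 0" "conic_form Q p = 0" "polar Q p q \<noteq> 0"
    by blast
  \<comment> \<open>As \<open>q\<close> lies on \<open>m\<close>, adding a multiple of it keeps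
    \<open>dot m y = 1\<close> while making the polar with \<open>p\<close> equal to 1. Then
    \<open>x\<close> is the second intersection of the line through \<open>p\<close> and
    \<open>y\<close> with the conic.\<close>
  define y where "y = r + scale ((1 - polar Q p r) / polar Q p q) q"
  define x where "x = y + scale (- conic_form Q y / 2) p"
  have "polar Q p y = 1"
    using pq by (simp add: y_def polar_add polar_scale)
  then have "conic_form Q x = 0"
    using pq two
    by (simp add: x_def conic_form_add conic_form_scale' polar_scale polar_commute[of Q y])
  moreover have "dot m x = 1"
    using pq r by (simp add: x_def y_def dot_add dot_scale)
  ultimately show ?thesis by blast
qed

lemma exists_finite_conic_point:
  assumes two: "(2::'a::field) \<noteq> 0"
    and sq: "s^2 = poly (Disc Q L) (t::'a)"
    and nz: "poly (pderiv (Disc Q L)) t \<noteq> 0"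
  shows "\<exists>P. on_conic Q P \<and> ell_finite L P \<and> (nonconstant_map L \<longrightarrow> ell L P = t)"
proof -
  define m where "m = den_coeffs L"
  define n where "n = line L t"
  have sq': "s^2 = dual Q n n" using sq by (simp add: n_def poly_Disc)
  have nz': "dual Q m n \<noteq> 0" using nz by (auto simp: m_def n_def poly_pderiv_Disc)
  have "\<exists>x. conic_form Q x = 0 \<and> dot m x = 1 \<and> (nonconstant_map L \<longrightarrow> dot n x = 0)"
  proof (cases "cross n m = (0, 0, 0)")
    case False
    show ?thesis using conic_point_on_given_line[OF two False sq' nz'] by blast
  next
    case True
    have "m \<noteq> (0, 0, 0)" using nz' by (cases Q; cases n) auto
    then obtain r where "dot m r = 1" using dot_eq_1_exists by blast
    then obtain u where u: "n = scale u m" using cross_eq_0_imp_scale[OF True] by blast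
    have "\<not> nonconstant_map L"
    proof
      assume nc: "nonconstant_map L"
      \<comment> \<open>Here the numerator is t + u times the denominator, so the map is constant
        and only finiteness of the point remains to be achieved.\<close>
      have "1 * ell_num L x + (- (t + u)) * ell_den L x = 0" for x
        using dot_line[of L t x] u
        by (simp add: n_def[symmetric] dot_scale m_def ell_den_eq_dot algebra_simps)
      then have "(1::'a) = 0" using nc unfolding nonconstant_map_def by blast
      then show False by simp
    qed
    moreover have u0: "u \<noteq> 0" and mm: "dual Q m m \<noteq> 0"
      using nz' u by (auto simp: dual_scale)
    have "(s / u)^2 = dual Q m m"
      using sq' u0 by (simp add: u dual_scale power2_eq_square field_simps)
    moreover from this have "s / u \<noteq> 0" using mm by auto
    ultimately show ?thesis using conic_point_off_secant[OF two] by blast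
  qed
  then obtain x where x: "conic_form Q x = 0" "dot m x = 1" "nonconstant_map L \<longrightarrow> dot n x = 0"
    by blast
  have "x \<noteq> (0, 0, 0)" using x(2) by (cases m) auto
  then obtain P where P: "has_coords P x" using has_coords_exists by blast
  show ?thesis
    using x dot_line[of L t x]
    by (intro exI[of _ P])
      (auto simp: on_conic_iff[OF P] ell_finite_iff[OF P] ell_eq[OF P] m_def n_def ell_den_eq_dot)
qed

lemma finite_conic_point_coords:
  assumes "on_conic Q P" "ell_finite L P"
  shows "\<exists>s. s^2 = poly (Disc Q L) (ell L P) \<and>
           (coord0 Q L (ell L P) \<noteq> 0 \<longrightarrow> has_coords P (coords Q L (ell L P) s))"
proof -
  obtain x where P: "has_coords P x" and x: "x \<noteq> (0, 0, 0)" by (rule obtain_coords)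
  let ?n = "line L (ell L P)"
  have "dot ?n x = 0"
    using assms(2) by (simp add: dot_line ell_finite_iff[OF P] ell_eq[OF P])
  moreover have "conic_form Q x = 0" using assms(1) by (simp add: on_conic_iff[OF P])
  ultimately obtain s where "s^2 = dual Q ?n ?n"
    "snd (snd (line_point Q ?n s)) \<noteq> 0 \<longrightarrow> (\<exists>u. u \<noteq> 0 \<and> line_point Q ?n s = scale u x)"
    using conic_point_on_line[OF _ x] by blast
  then show ?thesis
    using has_coords_scale[OF P] coord0_eq[of Q L _ s]
    by (intro exI[of _ s]) (auto simp: poly_Disc coords_eq)
qed

section \<open>Further square values of the discriminant\<close>

lemma Disc_square_exists:
  assumes two: "(2::'a::field) \<noteq> 0"
    and sq: "s^2 = poly (Disc Q L) (t::'a)"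
    and nz: "poly (pderiv (Disc Q L)) t \<noteq> 0"
  shows "\<exists>h. h \<noteq> 0 \<and> (\<exists>s'. s'^2 = poly (Disc Q L) (t + h))"
proof -
  define p where "p = poly (pderiv (Disc Q L)) t"
  define q where "q = dual Q (den_coeffs L) (den_coeffs L)"
  \<comment> \<open>\<open>z\<close> is the slope of a line through (t, s). Comparing (s + z h)^2
    with s^2 + p h + q h^2 and cancelling h leaves h (z^2 - q) = p - 2 s z; both factors must be
    nonzero for a second point.\<close>
  have "\<exists>z. z^2 \<noteq> q \<and> p - 2 * s * z \<noteq> 0"
  proof (cases "q = 0")
    case False
    then show ?thesis using nz by (intro exI[of _ 0]) (simp add: p_def)
  next
    case True
    have "p - 2 * s \<noteq> 0 \<or> p + 2 * s \<noteq> 0"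
    proof (rule ccontr)
      assume "\<not> ?thesis"
      then have "2 * p = 0" by (simp add: algebra_simps)
      then show False using two nz by (simp add: p_def)
    qed
    then show ?thesis
    proof
      assume "p - 2 * s \<noteq> 0"
      then show ?thesis using True by (intro exI[of _ 1]) simp
    next
      assume "p + 2 * s \<noteq> 0"
      then show ?thesis using True by (intro exI[of _ "- 1"]) simp
    qed
  qed
  then obtain z where z: "z^2 - q \<noteq> 0" "p - 2 * s * z \<noteq> 0" by auto
  define h where "h = (p - 2 * s * z) / (z^2 - q)"
  have "h * (z^2 - q) = p - 2 * s * z" using z by (simp add: h_def)
  then have "h * (h * (z^2 - q)) = h * (p - 2 * s * z)" by simp
  then have "(s + z * h)^2 = poly (Disc Q L) (t + h)"
    unfolding Disc_taylor sq[symmetric] p_def[symmetric] q_def[symmetric]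
    by (simp add: algebra_simps power2_eq_square)
  moreover have "h \<noteq> 0" using z by (simp add: h_def)
  ultimately show ?thesis by blast
qed

section \<open>The cubic curve and three-term progressions\<close>

lemma four_nonzero: "(2::'a::field) \<noteq> 0 \<Longrightarrow> (4::'a) \<noteq> 0"
  by (metis mult_2_right mult_eq_0_iff numeral_Bit0)

text \<open>Serves the difference zero: X = 0 kills the numerator 4 X Y, and the point other than
  the origin keeps the denominator nonzero.\<close>

lemma cubic_point_zero:
  assumes "(2::'a::field) \<noteq> 0" "(k::'a) \<noteq> 0"
  shows "on_cubic k 0 (- 4 * k) \<and> (- 4 * k)^2 + 2 * 0 * (- 4 * k) + k * 0^2 \<noteq> 0"
proof -
  have "(16::'a) = 4 * 4" by simp
  then have "(16::'a) \<noteq> 0" using four_nonzero[OF assms(1)] by (metis mult_eq_0_iff)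
  then show ?thesis using assms by (simp add: on_cubic_def power2_eq_square)
qed

text \<open>With \<open>T = Y / X\<close>, the equation \<open>g = - 2 X Y / (Y^2 + 2 X Y + k X^2)\<close> is a quadratic in \<open>T\<close>
  whose discriminant is a square iff \<open>(1 + g)^2 - k g^2\<close> is; then the cubic becomes a quadratic in
  \<open>X\<close> whose discriminant is a square iff \<open>(1 - g)^2 - k g^2\<close> is.\<close>

lemma cubic_point_exists:
  fixes g k :: "'a::field"
  assumes two: "(2::'a) \<noteq> 0" and g: "g \<noteq> 0"
    and p: "p^2 = (1 + g)^2 - k * g^2" and r: "r^2 = (1 - g)^2 - k * g^2"
    and k0: "k = 0 \<Longrightarrow> p \<noteq> 0 \<and> r \<noteq> 0"
  shows "\<exists>X Y. on_cubic k X Y \<and> Y^2 + 2 * X * Y + k * X^2 \<noteq> 0 \<and>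
           2 * g = - (4 * X * Y / (Y^2 + 2 * X * Y + k * X^2))"
proof -
  \<comment> \<open>The root 1 + g would give T = 0. If \<open>p\<close> equals it, then k = 0, and
    \<open>k0\<close> makes - p a different root.\<close>
  have "\<exists>e. e^2 = p^2 \<and> e \<noteq> 1 + g"
  proof (cases "p = 1 + g")
    case True
    have "p \<noteq> 0"
      using k0 p True g by auto
    then have "- p \<noteq> p" using two by (metis add_eq_0_iff mult_2 mult_eq_0_iff)
    then show ?thesis using True by (metis power2_minus)
  next
    case False
    then show ?thesis by blast
  qed
  then obtain e where e: "e^2 = (1 + g)^2 - k * g^2" "e \<noteq> 1 + g" using p by auto
  define T where "T = (e - (1 + g)) / g"
  have T: "T \<noteq> 0" "T * g = e - (1 + g)" using e g by (auto simp: T_def)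
  have "(T * g + (1 + g))^2 = (1 + g)^2 - k * g^2" using T e by simp
  then have "g * (g * (T^2 + 2 * T + k) + 2 * T) = 0"
    by (simp add: algebra_simps power2_eq_square)
  then have gT: "g * (T^2 + 2 * T + k) = - 2 * T"
    using g by (simp add: eq_neg_iff_add_eq_0)
  then have W: "T^2 + 2 * T + k \<noteq> 0" using T two by auto
  \<comment> \<open>Putting Y = T X into the cubic and dividing by X gives X^2 = b X + 4 k T, with
    discriminant c^2.\<close>
  define b where "b = T^2 + 4 * T - k"
  define c where "c = r * (T^2 + 2 * T + k)"
  have c: "c^2 = b^2 + 16 * k * T"
  proof -
    let ?w = "T^2 + 2 * T + k"
    have "c^2 = ((1 - g)^2 - k * g^2) * ?w^2"
      by (simp only: c_def power_mult_distrib r)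
    also have "\<dots> = (?w - g * ?w)^2 - k * (g * ?w)^2"
      by (simp add: algebra_simps power2_eq_square)
    also have "\<dots> = b^2 + 16 * k * T"
      unfolding gT b_def by (simp add: algebra_simps power2_eq_square)
    finally show ?thesis .
  qed
  \<comment> \<open>X must be nonzero to undo the division. For k = 0 the roots are 0 and
    \<open>b\<close>; otherwise their product - 4 k T is nonzero.\<close>
  have "\<exists>X. X^2 = b * X + 4 * k * T \<and> X \<noteq> 0"
  proof (cases "k = 0")
    case True
    have "c \<noteq> 0" using k0[OF True] W by (simp add: c_def)
    then have "b \<noteq> 0" using c True by auto
    then show ?thesis using True by (intro exI[of _ b]) (simp add: power2_eq_square)
  next
    case False
    define X where "X = (b + c) / 2"
    have "2 * X = b + c" using two by (simp add: X_def del: distrib_left_numeral)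
    then have "2 * X - b = c" by simp
    then have "(2 * X - b)^2 = b^2 + 16 * k * T" using c by simp
    then have "4 * (X^2 - b * X - 4 * k * T) = 0"
      by (simp add: algebra_simps power2_eq_square)
    then have "X^2 - b * X - 4 * k * T = 0"
      using four_nonzero[OF two] by (simp only: mult_eq_0_iff simp_thms)
    then have X: "X^2 = b * X + 4 * k * T"
      by (simp add: algebra_simps)
    moreover have "X \<noteq> 0"
      using X False T(1) four_nonzero[OF two] by auto
    ultimately show ?thesis by blast
  qed
  then obtain X where X: "X^2 = b * X + 4 * k * T" "X \<noteq> 0" by blast
  define Y where "Y = T * X"
  have den: "Y^2 + 2 * X * Y + k * X^2 = X^2 * (T^2 + 2 * T + k)"
    by (simp add: Y_def algebra_simps power2_eq_square)
  have "X * (X^2 - (b * X + 4 * k * T)) = 0" using X(1) by simp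
  then have "on_cubic k X Y"
    by (simp add: on_cubic_def Y_def b_def algebra_simps power2_eq_square power3_eq_cube)
  moreover have "Y^2 + 2 * X * Y + k * X^2 \<noteq> 0"
    using X(2) W by (simp add: den)
  moreover have "2 * g = - (4 * X * Y / (Y^2 + 2 * X * Y + k * X^2))"
  proof -
    have "g = - 2 * T / (T^2 + 2 * T + k)"
      by (rule eq_divide_imp[OF W gT])
    moreover have "4 * X * Y / (Y^2 + 2 * X * Y + k * X^2) = 4 * T / (T^2 + 2 * T + k)"
      unfolding den using X(2) W by (simp add: Y_def power2_eq_square)
    ultimately show ?thesis by simp
  qed
  ultimately show ?thesis by blast
qed

text \<open>\<open>zero\<close> and \<open>k0\<close> exclude exactly the progressions without such
  a cubic point. If D t = 0 the formula yields only 0. If k = 0, the difference 0 would force the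
  origin, and a zero of D at an outer term would force T = 0 or X = 0.\<close>

lemma Disc_progression_cubic_point:
  fixes Q :: "'a::field conic" and L :: "'a linmap" and t k \<delta> :: 'a
  defines "D \<equiv> poly (Disc Q L)" and "D' \<equiv> poly (pderiv (Disc Q L)) t"
  assumes two: "(2::'a) \<noteq> 0"
    and nz: "D' \<noteq> 0"
    and k: "k = (D'^2 - 2 * D t * poly (pderiv (pderiv (Disc Q L))) t) / D'^2"
    and s0: "s0^2 = D t" and s1: "s1^2 = D (t - \<delta>)" and s3: "s3^2 = D (t + \<delta>)"
    and zero: "D t = 0 \<Longrightarrow> \<delta> = 0"
    and k0: "k = 0 \<Longrightarrow> \<delta> \<noteq> 0 \<and> D (t - \<delta>) \<noteq> 0 \<and> D (t + \<delta>) \<noteq> 0"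
  shows "\<exists>X Y. on_cubic k X Y \<and> Y^2 + 2 * X * Y + k * X^2 \<noteq> 0 \<and>
           \<delta> = - (D t / D') * (4 * X * Y / (Y^2 + 2 * X * Y + k * X^2))"
proof (cases "\<delta> = 0")
  case True
  then have "k \<noteq> 0" using k0 by blast
  then show ?thesis
    using cubic_point_zero[OF two, of k] True by (intro exI[of _ 0] exI[of _ "- 4 * k"]) simp
next
  case False
  define q where "q = dual Q (den_coeffs L) (den_coeffs L)"
  define g where "g = D' * \<delta> / (2 * D t)"
  have Dt: "D t \<noteq> 0" and s0': "s0 \<noteq> 0" using zero False s0 by auto
  have k': "k * D'^2 = D'^2 - 4 * D t * q"
    using nz by (simp add: k poly_pderiv_pderiv_Disc q_def)
  have \<delta>: "D' * \<delta> = 2 * g * D t"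
    using Dt two by (simp add: g_def)
  \<comment> \<open>In the Taylor expansion D' \<delta> is 2 g D t, and the definition of
    \<open>k\<close> turns q \<delta>^2 into (1 - k) g^2 D t. The signs e = 1 and e = -1 give the
    two outer terms.\<close>
  have main: "D t * ((1 + e * g)^2 - k * g^2) = D (t + e * \<delta>)" if e: "e^2 = 1" for e
  proof -
    have "(4 * D t) * (D t * ((1 + e * g)^2 - k * g^2))
        = 4 * (D t)^2 + 4 * e * D t * (2 * g * D t) + e^2 * (2 * g * D t)^2 - k * (2 * g * D t)^2"
      by (simp add: algebra_simps power2_eq_square)
    also have "\<dots> = 4 * (D t)^2 + 4 * e * D t * (D' * \<delta>) + (D' * \<delta>)^2 - (k * D'^2) * \<delta>^2"
      unfolding \<delta>[symmetric] e by (simp add: algebra_simps power2_eq_square)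
    also have "\<dots> = 4 * D t * (D t + D' * (e * \<delta>) + q * (e^2 * \<delta>^2))"
      unfolding k' e by (simp add: algebra_simps power2_eq_square)
    also have "\<dots> = 4 * D t * D (t + e * \<delta>)"
      by (simp add: D_def D'_def q_def Disc_taylor power_mult_distrib)
    finally show ?thesis
      using Dt four_nonzero[OF two] by simp
  qed
  have p: "(s3 / s0)^2 = (1 + g)^2 - k * g^2"
    using main[of 1] s3 s0 Dt by (simp add: power_divide divide_eq_eq mult.commute)
  have r: "(s1 / s0)^2 = (1 - g)^2 - k * g^2"
    using main[of "- 1"] s1 s0 Dt by (simp add: power_divide divide_eq_eq mult.commute)
  have "k = 0 \<Longrightarrow> s3 / s0 \<noteq> 0 \<and> s1 / s0 \<noteq> 0"
    using k0 s1 s3 s0' by auto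
  moreover have "g \<noteq> 0" using False nz Dt two by (simp add: g_def)
  ultimately obtain X Y where XY: "on_cubic k X Y" "Y^2 + 2 * X * Y + k * X^2 \<noteq> 0"
      "2 * g = - (4 * X * Y / (Y^2 + 2 * X * Y + k * X^2))"
    using cubic_point_exists[OF two _ p r] by blast
  have "\<delta> = D t / D' * (2 * g)"
    using \<delta> nz by (simp add: field_simps)
  then have "\<delta> = - (D t / D') * (4 * X * Y / (Y^2 + 2 * X * Y + k * X^2))"
    unfolding XY(3) by simp
  then show ?thesis using XY by blast
qed

theorem theorem5:
  fixes Q :: "'a::field conic" and L :: "'a linmap" and t0 k :: 'a
  assumes "CHAR('a) \<noteq> 2"
    and "\<exists>s. s^2 = poly (Disc Q L) t0"
    and "poly (pderiv (Disc Q L)) t0 \<noteq> 0"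
    and "k = ((poly (pderiv (Disc Q L)) t0)^2
              - 2 * poly (Disc Q L) t0 * poly (pderiv (pderiv (Disc Q L))) t0)
             / (poly (pderiv (Disc Q L)) t0)^2"
  shows
    "(\<forall>n\<ge>2.
        (\<exists>t::nat \<Rightarrow> 'a. (\<exists>i\<in>{1..n}. \<exists>j\<in>{1..n}. t i \<noteq> t j) \<and>
                     (\<forall>i\<in>{1..n}. \<exists>s. s^2 = poly (Disc Q L) (t i))) \<and>
        (\<forall>t::nat \<Rightarrow> 'a. (\<forall>i\<in>{1..n}. \<exists>s. s^2 = poly (Disc Q L) (t i)) \<longrightarrow>
           (\<forall>i\<in>{1..n}. \<forall>s P. s^2 = poly (Disc Q L) (t i) \<and> has_coords P (coords Q L (t i) s)
              \<longrightarrow> on_conic Q P) \<and>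
           (\<forall>i\<in>{1..<n}. \<forall>s P s' P'.
              s^2 = poly (Disc Q L) (t i) \<and> has_coords P (coords Q L (t i) s) \<and>
              s'^2 = poly (Disc Q L) (t (Suc i)) \<and> has_coords P' (coords Q L (t (Suc i)) s') \<and>
              \<not> base_point L P \<and> \<not> base_point L P'
              \<longrightarrow> ell_finite L P \<and> ell_finite L P' \<and> ell L P' - ell L P = t (Suc i) - t i)))
     \<and>
     (\<exists>P. arith_prog Q L 3 P \<and> (nonconstant_map L \<longrightarrow> ell L (P 2) = t0))
     \<and>
     (\<forall>P. arith_prog Q L 3 P \<and> ell L (P 2) = t0 \<longrightarrow>
        (\<exists>\<delta>.
          (\<forall>(R, t) \<in> {(P 1, t0 - \<delta>), (P 2, t0), (P 3, t0 + \<delta>)}.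
             ell L R = t \<and>
             (\<exists>s. s^2 = poly (Disc Q L) t \<and>
                  (coord0 Q L t \<noteq> 0 \<longrightarrow> has_coords R (coords Q L t s)))) \<and>
          ((poly (Disc Q L) t0 = 0 \<longrightarrow> \<delta> = 0) \<and>
           (k = 0 \<longrightarrow> \<delta> \<noteq> 0 \<and> poly (Disc Q L) (t0 - \<delta>) \<noteq> 0 \<and> poly (Disc Q L) (t0 + \<delta>) \<noteq> 0)
           \<longrightarrow>
           (\<exists>X Y. on_cubic k X Y \<and> Y^2 + 2 * X * Y + k * X^2 \<noteq> 0 \<and>
              \<delta> = - (poly (Disc Q L) t0 / poly (pderiv (Disc Q L)) t0)
                    * (4 * X * Y / (Y^2 + 2 * X * Y + k * X^2))))))"
proof -
  let ?D = "poly (Disc Q L)"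
  have two: "(2::'a) \<noteq> 0"
    using assms(1) of_nat_eq_0_iff_char_dvd[where ?'a = 'a, of 2] prime_nat_iff[of 2] CHAR_not_1[where ?'a = 'a]
    by auto
  obtain s0 where s0: "s0^2 = ?D t0" using assms(2) by blast
  obtain h s' where h: "h \<noteq> 0" "s'^2 = ?D (t0 + h)"
    using Disc_square_exists[OF two s0 assms(3)] by blast
  have seq: "\<exists>t::nat \<Rightarrow> 'a. (\<exists>i\<in>{1..n}. \<exists>j\<in>{1..n}. t i \<noteq> t j) \<and>
          (\<forall>i\<in>{1..n}. \<exists>s. s^2 = ?D (t i))" if "n \<ge> 2" for n
  proof (intro exI conjI)
    \<comment> \<open>Two distinct values suffice for a non-constant sequence, so any length is
      possible even over a finite field.\<close>
    let ?t = "\<lambda>i::nat. if i = 1 then t0 else t0 + h"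
    show "\<exists>i\<in>{1..n}. \<exists>j\<in>{1..n}. ?t i \<noteq> ?t j"
      using that h(1) by (intro bexI[of _ 1] bexI[of _ 2]) auto
    show "\<forall>i\<in>{1..n}. \<exists>s. s^2 = ?D (?t i)"
      using s0 h(2) by auto
  qed
  have on_conic: "\<forall>i\<in>{1..n}. \<forall>s P. s^2 = ?D (t i) \<and> has_coords P (coords Q L (t i) s)
      \<longrightarrow> on_conic Q P" for n :: nat and t
    using on_conic_coords by blast
  have diff: "\<forall>i\<in>{1..<n}. \<forall>s P s' P'.
      s^2 = ?D (t i) \<and> has_coords P (coords Q L (t i) s) \<and>
      s'^2 = ?D (t (Suc i)) \<and> has_coords P' (coords Q L (t (Suc i)) s') \<and>
      \<not> base_point L P \<and> \<not> base_point L P'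
      \<longrightarrow> ell_finite L P \<and> ell_finite L P' \<and> ell L P' - ell L P = t (Suc i) - t i" for n t
    by (auto simp: ell_coords)
  have prog: "\<exists>P. arith_prog Q L 3 P \<and> (nonconstant_map L \<longrightarrow> ell L (P 2) = t0)"
  proof -
    obtain R where "on_conic Q R" "ell_finite L R" "nonconstant_map L \<longrightarrow> ell L R = t0"
      using exists_finite_conic_point[OF two s0 assms(3)] by blast
    then show ?thesis
      \<comment> \<open>The constant progression: \<open>arith_prog\<close> admits the common
        difference zero.\<close>
      by (intro exI[of _ "\<lambda>_. R"]) (simp add: arith_prog_def)
  qed
  have form: "\<exists>\<delta>.
          (\<forall>(R, t) \<in> {(P 1, t0 - \<delta>), (P 2, t0), (P 3, t0 + \<delta>)}.
             ell L R = t \<and>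
             (\<exists>s. s^2 = ?D t \<and> (coord0 Q L t \<noteq> 0 \<longrightarrow> has_coords R (coords Q L t s)))) \<and>
          ((?D t0 = 0 \<longrightarrow> \<delta> = 0) \<and>
           (k = 0 \<longrightarrow> \<delta> \<noteq> 0 \<and> ?D (t0 - \<delta>) \<noteq> 0 \<and> ?D (t0 + \<delta>) \<noteq> 0)
           \<longrightarrow>
           (\<exists>X Y. on_cubic k X Y \<and> Y^2 + 2 * X * Y + k * X^2 \<noteq> 0 \<and>
              \<delta> = - (?D t0 / poly (pderiv (Disc Q L)) t0)
                    * (4 * X * Y / (Y^2 + 2 * X * Y + k * X^2))))"
    if P: "arith_prog Q L 3 P" "ell L (P 2) = t0" for P
  proof -
    obtain \<delta> where \<delta>: "\<forall>i\<in>{1..<3}. ell L (P (Suc i)) - ell L (P i) = \<delta>"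
      using P(1) unfolding arith_prog_def by blast
    have "ell L (P 2) - ell L (P 1) = \<delta>" "ell L (P 3) - ell L (P 2) = \<delta>"
      using bspec[OF \<delta>, of 1] bspec[OF \<delta>, of 2] by (simp_all del: One_nat_def)
    then have ell: "ell L (P 1) = t0 - \<delta>" "ell L (P 3) = t0 + \<delta>"
      using P(2) by (auto simp: algebra_simps)
    have pt: "\<exists>s. s^2 = ?D (ell L (P i)) \<and>
        (coord0 Q L (ell L (P i)) \<noteq> 0 \<longrightarrow> has_coords (P i) (coords Q L (ell L (P i)) s))"
      if "i \<in> {1..3}" for i
      using P(1) that unfolding arith_prog_def by (intro finite_conic_point_coords) blast+
    have pts: "\<exists>s. s^2 = ?D (t0 - \<delta>) \<and>
          (coord0 Q L (t0 - \<delta>) \<noteq> 0 \<longrightarrow> has_coords (P 1) (coords Q L (t0 - \<delta>) s))"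
        "\<exists>s. s^2 = ?D t0 \<and> (coord0 Q L t0 \<noteq> 0 \<longrightarrow> has_coords (P 2) (coords Q L t0 s))"
        "\<exists>s. s^2 = ?D (t0 + \<delta>) \<and>
          (coord0 Q L (t0 + \<delta>) \<noteq> 0 \<longrightarrow> has_coords (P 3) (coords Q L (t0 + \<delta>) s))"
      using pt[of 1] pt[of 2] pt[of 3] unfolding ell P(2) by simp_all
    obtain s1 s3 where s: "s1^2 = ?D (t0 - \<delta>)" "s3^2 = ?D (t0 + \<delta>)" using pts by blast
    show ?thesis
    proof (rule exI[of _ \<delta>], rule conjI)
      show "\<forall>(R, t) \<in> {(P 1, t0 - \<delta>), (P 2, t0), (P 3, t0 + \<delta>)}.
             ell L R = t \<and>
             (\<exists>s. s^2 = ?D t \<and> (coord0 Q L t \<noteq> 0 \<longrightarrow> has_coords R (coords Q L t s)))"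
        using pts ell P(2) by (simp only: ball_simps split_conv simp_thms)
    qed (rule impI, rule Disc_progression_cubic_point[OF two assms(3,4) s0 s]; blast)
  qed
  show ?thesis
    by (intro conjI allI impI) (rule seq, assumption, rule on_conic, rule diff, rule prog,
      rule form, erule conjunct1, erule conjunct2)
qed

end
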